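(* If $f\in\mathcal{S}$, then $$T_{2,1}(f^{-1})=T_{2,1}(f)\quad\text{and}\quad T_{3,1}(f^{-1})=T_{3,1}(f).$$
   Context: Let $\mathbb{D}=\{z\in\mathbb{C}:|z|<1\}$. $\mathcal{A}$ is the class of functions $f$ analytic in $\mathbb{D}$ with $f(0)=0$, $f'(0)=1$, i.e. $f(z)=z+a_2z^2+a_3z^3+\cdots$; $\mathcal{S}$ is the class of functions in $\mathcal{A}$ that are univalent (injective) in $\mathbb{D}$. For $f\in\mathcal{S}$ the inverse $f^{-1}$ is defined at least on the disk $|w|<1/4$ (Koebe's 1/4 theorem) and has there an expansion $f^{-1}(w)=w+A_2w^2+A_3w^3+\cdots$. For a function $g(z)=z+b_2z^2+b_3z^3+\cdots$ analytic near $0$ (with $b_1=1$) the Toeplitz determinant $T_{q,n}(g)$ is the determinant of the $q\times q$ matrix whose diagonal entries are $b_n$, whose $(i,j)$ entry is $b_{n+j-i}$ for $j>i$, and whose $(i,j)$ entry is $\overline{b_{n+i-j}}$ for $i>j$. In particular $$T_{2,1}(g)=1-|b_2|^2,\qquad T_{3,1}(g)=2\,\mathrm{Re}\,(b_2^2\overline{b_3})-2|b_2|^2-|b_3|^2+1.$$ $T_{q,n}(f^{-1})$ is this determinant formed from the coefficients $A_k$ of $f^{-1}$. *)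

theory Defs
  imports "HOL-Complex_Analysis.Complex_Analysis" "Jordan_Normal_Form.Determinant"
begin

definition class_A :: "(complex \<Rightarrow> complex) set" where
  "class_A = {f. f holomorphic_on ball 0 1 \<and> f 0 = 0 \<and> deriv f 0 = 1}"

definition class_S :: "(complex \<Rightarrow> complex) set" where
  "class_S = {f \<in> class_A. inj_on f (ball 0 1)}"

(* The inverse lives on the image of the unit disk, an open neighbourhood of 0; the values
   of the_inv_into elsewhere are irrelevant because only the germ at 0 is used. *)
definition disk_inverse :: "(complex \<Rightarrow> complex) \<Rightarrow> complex \<Rightarrow> complex" where
  "disk_inverse f = the_inv_into (ball 0 1) f"

definition taylor_coeff :: "(complex \<Rightarrow> complex) \<Rightarrow> nat \<Rightarrow> complex" where
  "taylor_coeff g k = fps_nth (fps_expansion g 0) k"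

(* Matrix indices run from 0 here; the entries depend only on j - i, so this agrees with
   1-based indexing. *)
definition toeplitz_det :: "nat \<Rightarrow> nat \<Rightarrow> (complex \<Rightarrow> complex) \<Rightarrow> complex" where
  "toeplitz_det q n g =
     Determinant.det (Matrix.mat q q (\<lambda>(i, j).
       if i \<le> j then taylor_coeff g (n + (j - i)) else cnj (taylor_coeff g (n + (i - j)))))"

end

theory Submission
  imports Defs
begin

text \<open>
  Write \<open>a\<^sub>k\<close> for the coefficients of \<open>f\<close> and \<open>A\<^sub>k\<close> for those of its inverse.  Expanding the
  determinants for a normalised series (\<open>a\<^sub>1 = 1\<close>) gives

    \<open>T\<^sub>2 = 1 - |a\<^sub>2|\<^sup>2\<close> and \<open>T\<^sub>3 = (1 - |a\<^sub>2|\<^sup>2)\<^sup>2 - |a\<^sub>3 - a\<^sub>2\<^sup>2|\<^sup>2\<close>,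

  so both depend only on the moduli of \<open>a\<^sub>2\<close> and of \<open>a\<^sub>3 - a\<^sub>2\<^sup>2\<close>.  Inversion changes just the sign
  of these two quantities: comparing coefficients in \<open>f\<^sup>-\<^sup>1 (f z) = z\<close> yields \<open>A\<^sub>2 = - a\<^sub>2\<close> and
  \<open>A\<^sub>3 = 2 a\<^sub>2\<^sup>2 - a\<^sub>3\<close>, that is \<open>A\<^sub>3 - A\<^sub>2\<^sup>2 = - (a\<^sub>3 - a\<^sub>2\<^sup>2)\<close>.  The determinant formulas are
  \<open>toeplitz_det_2_1_normalised\<close> and \<open>toeplitz_det_3_1_normalised\<close>, the coefficient relations are
  \<open>fps_left_inverse_coeffs\<close>, and \<open>fps_expansion_the_inv_into_compose\<close> transfers them from formal
  power series to the functions.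
\<close>

lemma det_mat_2:
  fixes h :: "nat \<times> nat \<Rightarrow> 'a :: comm_ring_1"
  shows "Determinant.det (Matrix.mat 2 2 h) = h (0, 0) * h (1, 1) - h (0, 1) * h (1, 0)"
  by (subst laplace_expansion_row[where n = 2 and i = 0])
     (auto simp: numeral_2_eq_2 cofactor_def mat_delete_def det_single)

lemma det_mat_3:
  fixes h :: "nat \<times> nat \<Rightarrow> 'a :: comm_ring_1"
  shows "Determinant.det (Matrix.mat 3 3 h) =
           h (0, 0) * (h (1, 1) * h (2, 2) - h (1, 2) * h (2, 1))
         - h (0, 1) * (h (1, 0) * h (2, 2) - h (1, 2) * h (2, 0))
         + h (0, 2) * (h (1, 0) * h (2, 1) - h (1, 1) * h (2, 0))"
    (is "_ = ?rhs")
proof -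
  have minor: "mat_delete (Matrix.mat 3 3 h) 0 j =
      Matrix.mat 2 2 (\<lambda>(i, k). h (Suc i, if k < j then k else Suc k))" for j
    by (auto simp: mat_delete_def intro!: cong_mat)
  have "Determinant.det (Matrix.mat 3 3 h) =
      (\<Sum>j\<in>{0, 1, 2}. Matrix.mat 3 3 h $$ (0, j) * cofactor (Matrix.mat 3 3 h) 0 j)"
    by (subst laplace_expansion_row[where n = 3 and i = 0]) (auto simp: eval_nat_numeral)
  also have "\<dots> = ?rhs"
    unfolding cofactor_def minor det_mat_2 by (simp add: algebra_simps numeral_2_eq_2)
  finally show ?thesis .
qed

lemma toeplitz_det_2_1_normalised:
  assumes "taylor_coeff g 1 = 1"
  shows "toeplitz_det 2 1 g = 1 - taylor_coeff g 2 * cnj (taylor_coeff g 2)"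
  unfolding toeplitz_det_def det_mat_2 using assms by (simp add: numeral_2_eq_2)

text \<open>
  The determinant is real and quadratic in \<open>b\<^sub>3\<close>.  Completing the square centres it at
  \<open>b\<^sub>2\<^sup>2\<close>, so that \<open>b\<^sub>3\<close> enters only through \<open>b\<^sub>3 - b\<^sub>2\<^sup>2\<close>, which inversion merely negates.
\<close>
lemma toeplitz_det_3_1_normalised:
  fixes g :: "complex \<Rightarrow> complex"
  defines "b \<equiv> taylor_coeff g"
  assumes "b 1 = 1"
  shows "toeplitz_det 3 1 g =
           (1 - b 2 * cnj (b 2))\<^sup>2 - (b 3 - (b 2)\<^sup>2) * cnj (b 3 - (b 2)\<^sup>2)"
  unfolding toeplitz_det_def det_mat_3 b_def[symmetric]
  using assms(2) by (simp add: eval_nat_numeral algebra_simps)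

text \<open>
  Since \<open>F\<close> starts with \<open>fps_X\<close>, the power \<open>F ^ i\<close> starts with \<open>fps_X ^ i\<close>, so the system for the
  coefficients of \<open>G\<close> is unitriangular and can be solved from the lowest index upwards.
\<close>
lemma fps_left_inverse_coeffs:
  fixes F G :: "'a :: comm_ring_1 fps"
  assumes inv: "G oo F = fps_X" and F0: "fps_nth F 0 = 0" and F1: "fps_nth F 1 = 1"
  shows "fps_nth G 1 = 1" "fps_nth G 2 = - fps_nth F 2"
    "fps_nth G 3 = 2 * (fps_nth F 2)\<^sup>2 - fps_nth F 3"
proof -
  have coeff: "(\<Sum>i=0..n. fps_nth G i * fps_nth (F ^ i) n) = fps_nth fps_X n" for n
    using inv by (simp add: fps_compose_nth flip: inv)
  show G1: "fps_nth G 1 = 1"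
    using coeff[of 1] F1 by simp
  show G2: "fps_nth G 2 = - fps_nth F 2"
    using coeff[of 2] F0 F1 G1
    by (simp add: eval_nat_numeral fps_mult_nth add_eq_0_iff)
  show "fps_nth G 3 = 2 * (fps_nth F 2)\<^sup>2 - fps_nth F 3"
    using coeff[of 3] F0 F1 G1 G2
    by (simp add: eval_nat_numeral fps_mult_nth add_eq_0_iff algebra_simps)
qed

text \<open>
  An injective holomorphic map is open and has a holomorphic inverse on its image, a neighbourhood
  of \<open>0\<close>.  Hence the formal expansion of the inverse there is a convergent one, and the identity
  of functions becomes an identity of power series because expansions are unique.
\<close>
lemma fps_expansion_the_inv_into_compose:
  assumes hol: "f holomorphic_on S" and S: "open S" "0 \<in> S" and inj: "inj_on f S"
    and f0: "f 0 = 0"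
  shows "fps_expansion (the_inv_into S f) 0 oo fps_expansion f 0 = fps_X"
proof -
  define g where "g = the_inv_into S f"
  have gf: "g (f z) = z" if "z \<in> S" for z
    using that inj by (simp add: g_def the_inv_into_f_f)
  obtain h where h: "h holomorphic_on f ` S" "\<And>z. z \<in> S \<Longrightarrow> h (f z) = z"
    using holomorphic_has_inverse[OF hol S(1) inj] by metis
  \<comment> \<open>The holomorphic inverse \<open>h\<close> is known only by its values on the image, where it equals \<open>g\<close>.\<close>
  have "g holomorphic_on f ` S"
    using h gf by (elim holomorphic_transform) auto
  moreover have "open (f ` S)"
    by (rule open_mapping_thm3[OF hol S(1) inj])
  moreover have "0 \<in> f ` S"
    using f0 S(2) by force
  ultimately have G: "g has_fps_expansion fps_expansion g 0"
    by (intro has_fps_expansion_fps_expansion)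
  have F: "f has_fps_expansion fps_expansion f 0"
    by (rule has_fps_expansion_fps_expansion[OF S hol])
  have "(g \<circ> f) has_fps_expansion (fps_expansion g 0 oo fps_expansion f 0)"
    by (intro has_fps_expansion_compose F G) (simp add: fps_expansion_def f0)
  moreover have "eventually (\<lambda>z. (g \<circ> f) z = z) (nhds 0)"
    using eventually_nhds_in_open[OF S] by eventually_elim (simp add: gf)
  hence "(g \<circ> f) has_fps_expansion fps_X \<longleftrightarrow> (\<lambda>z::complex. z) has_fps_expansion fps_X"
    by (rule has_fps_expansion_cong) (rule refl)
  hence "(g \<circ> f) has_fps_expansion fps_X"
    by (simp add: has_fps_expansion_fps_X)
  ultimately show ?thesis
    unfolding g_def by (rule fps_expansion_unique_complex)
qed

theorem theorem1:
  fixes f :: "complex \<Rightarrow> complex"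
  assumes "f \<in> class_S"
  shows "toeplitz_det 2 1 (disk_inverse f) = toeplitz_det 2 1 f \<and>
         toeplitz_det 3 1 (disk_inverse f) = toeplitz_det 3 1 f"
proof -
  define a where "a = taylor_coeff f"
  define A where "A = taylor_coeff (disk_inverse f)"
  have f: "f holomorphic_on ball 0 1" "inj_on f (ball 0 1)" "f 0 = 0" "deriv f 0 = 1"
    using assms by (auto simp: class_S_def class_A_def)
  have a: "a 0 = 0" "a 1 = 1"
    using f by (simp_all add: a_def taylor_coeff_def fps_expansion_def)
  have "fps_expansion (disk_inverse f) 0 oo fps_expansion f 0 = fps_X"
    unfolding disk_inverse_def using f by (intro fps_expansion_the_inv_into_compose) auto
  note A = fps_left_inverse_coeffs[OF this,
      folded taylor_coeff_def a_def A_def, OF a]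
  have diff: "A 3 - (A 2)\<^sup>2 = - (a 3 - (a 2)\<^sup>2)"
    by (simp add: A)
  have "toeplitz_det 2 1 (disk_inverse f) = toeplitz_det 2 1 f"
    using toeplitz_det_2_1_normalised[of f] toeplitz_det_2_1_normalised[of "disk_inverse f"] a A(1,2)
    by (simp flip: a_def A_def)
  moreover have "toeplitz_det 3 1 (disk_inverse f) = toeplitz_det 3 1 f"
  proof -
    have "toeplitz_det 3 1 (disk_inverse f) =
        (1 - A 2 * cnj (A 2))\<^sup>2 - (A 3 - (A 2)\<^sup>2) * cnj (A 3 - (A 2)\<^sup>2)"
      using A(1) unfolding A_def by (rule toeplitz_det_3_1_normalised)
    also have "\<dots> = (1 - a 2 * cnj (a 2))\<^sup>2 - (a 3 - (a 2)\<^sup>2) * cnj (a 3 - (a 2)\<^sup>2)"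
      unfolding diff unfolding A(2) complex_cnj_minus minus_mult_minus ..
    also have "\<dots> = toeplitz_det 3 1 f"
      using a(2) unfolding a_def by (rule toeplitz_det_3_1_normalised[symmetric])
    finally show ?thesis .
  qed
  ultimately show ?thesis ..
qed

end
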